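(* Let $n \ge 4$ be an even integer and let $G$ be a finite solvable group whose character degree graph $\Delta(G)$ has exactly $n$ vertices and is $(n-2)$-regular. Let $n_1$ be an integer with $1\le n_1\le \frac n2$, and let $\Delta(G_1)$ be a character degree graph of a finite solvable group $G_1$ which is the supergraph of $\Delta(G)$, on the same $n$ vertices, obtained by adding $n_1$ new edges (each joining a pair of vertices non-adjacent in $\Delta(G)$). Then the Laplacian spectrum of $\Delta(G_1)$ is $$\begin{pmatrix} 0 & n-2 & n\\ 1 & \frac n2-n_1 & \left(\frac n2+n_1\right)-1\end{pmatrix}.$$
   Context: For a finite group $G$, $\mathrm{Irr}(G)$ is the set of complex irreducible characters of $G$, $\mathrm{cd}(G)=\{\chi(1) : \chi\in \mathrm{Irr}(G)\}$, and $\rho(G)$ is the set of primes dividing some element of $\mathrm{cd}(G)$. The character degree graph $\Delta(G)$ is the simple undirected graph with vertex set $\rho(G)$ in which distinct primes $p,q$ are adjacent if and only if $pq$ divides some $r\in \mathrm{cd}(G)$. Graphs are considered up to isomorphism. The Laplacian matrix of a finite simple graph $\Gamma$ is $L(\Gamma)=D(\Gamma)-A(\Gamma)$, with $D(\Gamma)$ the diagonal matrix of vertex degrees and $A(\Gamma)$ the adjacency matrix; the Laplacian spectrum is the spectrum of $L(\Gamma)$, displayed as a two-row array with eigenvalues in the first row and their multiplicities in the second row (an entry with multiplicity $0$ means that the value does not occur). *)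

theory Defs
  imports
    "HOL-Algebra.Solvable_Groups"
    "HOL-Computational_Algebra.Computational_Algebra"
    "Jordan_Normal_Form.Char_Poly"
    "Jordan_Normal_Form.VS_Connect"
    "Graph_Theory.Graph_Theory"
begin

section \<open>Complex irreducible characters and their degrees\<close>

definition trace_mat :: "'a::comm_monoid_add mat \<Rightarrow> 'a" where
  "trace_mat A = (\<Sum>i<dim_row A. A $$ (i, i))"

text \<open>A representation of dimension \<open>d\<close> is a homomorphism into \<open>GL(d, \<complex>)\<close>,
  the group of units of the matrix ring.\<close>

definition representation ::
    "('a, 'c) monoid_scheme \<Rightarrow> nat \<Rightarrow> ('a \<Rightarrow> complex mat) \<Rightarrow> bool" where
  "representation G d R \<longleftrightarrow> R \<in> hom G (units_of (ring_mat TYPE(complex) d ()))"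

definition irreducible_representation ::
    "('a, 'c) monoid_scheme \<Rightarrow> nat \<Rightarrow> ('a \<Rightarrow> complex mat) \<Rightarrow> bool" where
  "irreducible_representation G d R \<longleftrightarrow>
     representation G d R \<and> d \<noteq> 0 \<and>
     (\<forall>W. subspace class_ring W (module_vec TYPE(complex) d) \<longrightarrow>
          (\<forall>g\<in>carrier G. \<forall>w\<in>W. R g *\<^sub>v w \<in> W) \<longrightarrow>
          W = {0\<^sub>v d} \<or> W = carrier_vec d)"

definition Irr :: "('a, 'c) monoid_scheme \<Rightarrow> ('a \<Rightarrow> complex) set" where
  "Irr G = {\<chi>. \<exists>d R. irreducible_representation G d R \<and>
                  \<chi> = (\<lambda>g\<in>carrier G. trace_mat (R g))}"

definition cd :: "('a, 'c) monoid_scheme \<Rightarrow> nat set" where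
  "cd G = {m. \<exists>\<chi>\<in>Irr G. \<chi> \<one>\<^bsub>G\<^esub> = of_nat m}"

definition rho :: "('a, 'c) monoid_scheme \<Rightarrow> nat set" where
  "rho G = {p. Factorial_Ring.prime p \<and> (\<exists>r\<in>cd G. p dvd r)}"


section \<open>Simple graphs and the character degree graph\<close>

text \<open>As in \<open>Graph_Theory\<close>, a simple graph is a symmetric loop-free digraph
  without parallel arcs: an edge \<open>{u, v}\<close> is the pair of arcs \<open>(u, v)\<close>, \<open>(v, u)\<close>,
  and the degree of a vertex is its \<open>out_degree\<close>.\<close>

definition degree_graph :: "('a, 'c) monoid_scheme \<Rightarrow> nat pair_pre_digraph" where
  "degree_graph G =
     \<lparr> pverts = rho G,
       parcs = {(p, q). p \<in> rho G \<and> q \<in> rho G \<and> p \<noteq> q \<and> (\<exists>r\<in>cd G. p * q dvd r)} \<rparr>"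

lemma degree_graph_bidirected: "pair_bidirected_digraph (degree_graph G)"
  by unfold_locales
    (auto simp: degree_graph_def symmetric_def with_proj_def arcs_ends_conv sym_def
      image_iff mult.commute)

lemma degree_graph_pair_graph:
  assumes "finite (rho G)"
  shows "pair_graph (degree_graph G)"
proof -
  interpret pair_bidirected_digraph "degree_graph G" by (rule degree_graph_bidirected)
  have "parcs (degree_graph G) \<subseteq> rho G \<times> rho G" by (auto simp: degree_graph_def)
  then have "finite (parcs (degree_graph G))" using assms finite_subset by blast
  then show ?thesis using assms by unfold_locales (auto simp: degree_graph_def)
qed

definition regular_graph :: "nat \<Rightarrow> 'a pair_pre_digraph \<Rightarrow> bool" where
  "regular_graph k \<Gamma> \<longleftrightarrow> (\<forall>v\<in>pverts \<Gamma>. out_degree (with_proj \<Gamma>) v = k)"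

definition nonedges :: "'a pair_pre_digraph \<Rightarrow> 'a set set" where
  "nonedges \<Gamma> = {{u, v} |u v. u \<in> pverts \<Gamma> \<and> v \<in> pverts \<Gamma> \<and> u \<noteq> v \<and> (u, v) \<notin> parcs \<Gamma>}"

definition adds_edges :: "nat \<Rightarrow> 'a pair_pre_digraph \<Rightarrow> 'a pair_pre_digraph \<Rightarrow> bool" where
  "adds_edges k \<Gamma> \<Gamma>' \<longleftrightarrow>
     (\<exists>N. N \<subseteq> nonedges \<Gamma> \<and> finite N \<and> card N = k \<and>
          pverts \<Gamma>' = pverts \<Gamma> \<and> parcs \<Gamma>' = parcs \<Gamma> \<union> {(u, v). {u, v} \<in> N})"


section \<open>The Laplacian spectrum\<close>

text \<open>Rows and columns are indexed by the vertices in increasing order; the spectrum does not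
  depend on this choice.\<close>

definition vertex_list :: "'a::linorder pair_pre_digraph \<Rightarrow> 'a list" where
  "vertex_list \<Gamma> = sorted_list_of_set (pverts \<Gamma>)"

definition adjacency_mat :: "'a::linorder pair_pre_digraph \<Rightarrow> complex mat" where
  "adjacency_mat \<Gamma> = (let vs = vertex_list \<Gamma>; n = length vs in
     mat n n (\<lambda>(i, j). if (vs ! i, vs ! j) \<in> parcs \<Gamma> then 1 else 0))"

definition degree_mat :: "'a::linorder pair_pre_digraph \<Rightarrow> complex mat" where
  "degree_mat \<Gamma> = (let vs = vertex_list \<Gamma>; n = length vs in
     mat n n (\<lambda>(i, j). if i = j then of_nat (out_degree (with_proj \<Gamma>) (vs ! i)) else 0))"

definition laplacian_mat :: "'a::linorder pair_pre_digraph \<Rightarrow> complex mat" where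
  "laplacian_mat \<Gamma> = degree_mat \<Gamma> - adjacency_mat \<Gamma>"

text \<open>The multiset of complex eigenvalues, counted with algebraic multiplicity.\<close>

definition laplacian_spectrum :: "'a::linorder pair_pre_digraph \<Rightarrow> complex multiset" where
  "laplacian_spectrum \<Gamma> = proots (char_poly (laplacian_mat \<Gamma>))"

end

(* The complement of Delta(G1) is a matching with n/2 - n1 edges. If tau is the involution swapping
   matched vertices, then L = (n-1) I + P_tau - J. An eigenvector for a nonzero eigenvalue has
   coordinate sum 0, so it is an eigenvector of P_tau, and the eigenvalues lie in {0, n-2, n}. The
   traces of L and L^2 determine the multiplicities. *)

theory Submission
  imports Defs "Jordan_Normal_Form.Schur_Decomposition"
begin

no_notation fps_nth (infixl "$" 75)

section \<open>Power sums of eigenvalues\<close>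

lemma trace_mat_mult_commute:
  fixes A B :: "'a::comm_semiring_0 mat"
  assumes "A \<in> carrier_mat n m" "B \<in> carrier_mat m n"
  shows "trace_mat (A * B) = trace_mat (B * A)"
proof -
  have "trace_mat (A * B) = (\<Sum>i<n. \<Sum>j<m. A $$ (i, j) * B $$ (j, i))"
    using assms by (simp add: trace_mat_def scalar_prod_def atLeast0LessThan)
  also have "\<dots> = (\<Sum>j<m. \<Sum>i<n. B $$ (j, i) * A $$ (i, j))"
    by (subst sum.swap) (simp add: mult.commute)
  also have "\<dots> = trace_mat (B * A)"
    using assms by (simp add: trace_mat_def scalar_prod_def atLeast0LessThan)
  finally show ?thesis .
qed

text \<open>Cyclicity of the trace moves \<open>P\<close> to the right end of
  \<open>P * B * Q\<close>, where \<open>Q * P\<close> cancels.\<close>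

lemma trace_mat_similar:
  fixes A :: "'a::comm_semiring_1 mat"
  assumes "similar_mat_wit A B P Q"
  shows "trace_mat A = trace_mat B"
proof -
  define n where "n = dim_row A"
  note wit = similar_mat_witD[OF n_def assms]
  have "trace_mat A = trace_mat (P * (B * Q))"
    using wit by (simp add: assoc_mult_mat[of _ n n _ n _ n])
  also have "\<dots> = trace_mat (B * Q * P)"
    by (rule trace_mat_mult_commute) (use wit in auto)
  also have "B * Q * P = B"
    using wit by (simp add: assoc_mult_mat[of _ n n _ n _ n])
  finally show ?thesis .
qed

text \<open>In the sum for entry \<open>(i, j)\<close> of the product only indices \<open>k\<close>
  with i \<le> k \<le> j can contribute. This range is empty below the diagonal and equals
  \<open>{i}\<close> on it.\<close>

lemma upper_triangular_mult:
  fixes A B :: "'a::semiring_0 mat"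
  assumes A: "A \<in> carrier_mat n n" and B: "B \<in> carrier_mat n n"
    and "upper_triangular A" "upper_triangular B"
  shows "upper_triangular (A * B)"
    and "i < n \<Longrightarrow> (A * B) $$ (i, i) = A $$ (i, i) * B $$ (i, i)"
proof -
  have tri: "A $$ (i, k) * B $$ (k, j) = 0" if "k < i \<or> j < k" "i < n" "k < n" for i j k
    using assms that by (auto simp: upper_triangular_def)
  have entry: "(A * B) $$ (i, j) = (\<Sum>k<n. A $$ (i, k) * B $$ (k, j))" if "i < n" "j < n" for i j
    using A B that by (simp add: scalar_prod_def atLeast0LessThan)
  show "upper_triangular (A * B)"
  proof
    fix i j assume "j < i" "i < dim_row (A * B)"
    then have ij: "j < i" "i < n" using A by auto
    have "(\<Sum>k<n. A $$ (i, k) * B $$ (k, j)) = 0"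
      by (rule sum.neutral) (use ij in \<open>auto intro!: tri\<close>)
    then show "(A * B) $$ (i, j) = 0" using entry ij by simp
  qed
  assume i: "i < n"
  have "(\<Sum>k<n. A $$ (i, k) * B $$ (k, i)) = (\<Sum>k\<in>{i}. A $$ (i, k) * B $$ (k, i))"
    by (rule sum.mono_neutral_right) (use i in \<open>auto intro!: tri\<close>)
  then show "(A * B) $$ (i, i) = A $$ (i, i) * B $$ (i, i)" using entry i by simp
qed

lemma upper_triangular_pow:
  fixes A :: "'a::semiring_1 mat"
  assumes A: "A \<in> carrier_mat n n" and ut: "upper_triangular A"
  shows "upper_triangular (A ^\<^sub>m k) \<and> (\<forall>i<n. (A ^\<^sub>m k) $$ (i, i) = A $$ (i, i) ^ k)"
proof (induction k)
  case 0
  then show ?case using A by (auto simp: upper_triangular_def)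
next
  case (Suc k)
  have "A ^\<^sub>m k \<in> carrier_mat n n" using A by (rule pow_carrier_mat)
  then show ?case
    using upper_triangular_mult[OF _ A conjunct1[OF Suc] ut] Suc
    by (simp add: power_commutes)
qed

text \<open>Links the multiset \<open>proots\<close> used in the definition of the spectrum to the
  eigenvalue list that indexes a Schur decomposition.\<close>

lemma proots_prod_linear_factors:
  fixes es :: "'a::idom list"
  shows "proots (\<Prod>e\<leftarrow>es. [:- e, 1:]) = mset es"
proof (induction es)
  case (Cons e es)
  have "(\<Prod>e\<leftarrow>es. [:- e, 1:]) \<noteq> 0" by (auto simp: prod_list_zero_iff)
  then have "proots ([:- e, 1:] * (\<Prod>e\<leftarrow>es. [:- e, 1:])) = add_mset e (mset es)"
    by (subst proots_mult) (auto simp: Cons simp del: mult_pCons_left)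
  then show ?case by simp
qed simp

text \<open>By Schur, \<open>A\<close> is similar to an upper triangular matrix with diagonal
  \<open>es\<close>. Powers preserve the similarity and the triangular form, and they act entrywise
  on the diagonal.\<close>

lemma trace_mat_pow_eq_sum_eigenvalues:
  fixes A :: "complex mat"
  assumes A: "A \<in> carrier_mat n n" and es: "char_poly A = (\<Prod>e\<leftarrow>es. [:- e, 1:])"
  shows "trace_mat (A ^\<^sub>m k) = (\<Sum>e\<leftarrow>es. e ^ k)"
proof -
  obtain B P Q where "schur_decomposition A es = (B, P, Q)"
    by (cases "schur_decomposition A es")
  then have wit: "similar_mat_wit A B P Q" and ut: "upper_triangular B"
    and diag: "diag_mat B = es"
    using schur_decomposition[OF A es] by auto
  have B: "B \<in> carrier_mat n n" using similar_mat_witD2[OF A wit] by blast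
  have "trace_mat (A ^\<^sub>m k) = trace_mat (B ^\<^sub>m k)"
    by (rule trace_mat_similar[OF similar_mat_wit_pow[OF wit]])
  also have "\<dots> = (\<Sum>i<n. B $$ (i, i) ^ k)"
    using upper_triangular_pow[OF B ut] B by (simp add: trace_mat_def)
  also have "\<dots> = (\<Sum>e\<leftarrow>es. e ^ k)"
    using B by (simp add: diag[symmetric] diag_mat_def interv_sum_list_conv_sum_set_nat
        comp_def atLeast0LessThan)
  finally show ?thesis .
qed

section \<open>Complements of matchings\<close>

text \<open>Here \<open>A\<close> is d I + P - J with d = n - 1. Adding up the rows of A v = x v
  shows that the coordinate sum of \<open>v\<close> vanishes when \<open>x\<close> is nonzero. Then
  J v = 0, so P v = (x - d) v, and P^2 = I forces x - d to be 1 or -1.\<close>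

lemma eigenvalues_complement_matching:
  fixes A :: "complex mat" and n :: nat
  defines "d \<equiv> (of_nat n - 1 :: complex)"
  assumes \<sigma>: "\<And>i. i < n \<Longrightarrow> \<sigma> i < n" "\<And>i. i < n \<Longrightarrow> \<sigma> (\<sigma> i) = i"
    and A: "A = mat n n (\<lambda>(i, j). (if i = j then d else 0) + (if j = \<sigma> i then 1 else 0) - 1)"
    and ev: "eigenvalue A x"
  shows "x \<in> {0, of_nat n - 2, of_nat n}"
proof (cases "x = 0")
  case False
  from ev obtain v where v: "v \<in> carrier_vec n" "v \<noteq> 0\<^sub>v n" "A *\<^sub>v v = x \<cdot>\<^sub>v v"
    unfolding eigenvalue_def eigenvector_def by (auto simp: A)
  define S where "S = (\<Sum>j<n. v $ j)"
  have row: "d * v $ i + v $ \<sigma> i - S = x * v $ i" if i: "i < n" for i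
  proof -
    have "x * v $ i = (A *\<^sub>v v) $ i" using v i by simp
    also have "\<dots> = (\<Sum>j<n. (if i = j then d * v $ j else 0) + (if j = \<sigma> i then v $ j else 0) - v $ j)"
      using i v(1) by (auto simp: A scalar_prod_def atLeast0LessThan algebra_simps intro!: sum.cong)
    also have "\<dots> = d * v $ i + v $ \<sigma> i - S"
      using i \<sigma>(1)[OF i] by (simp add: sum.distrib sum_subtractf S_def)
    finally show ?thesis ..
  qed
  have "(\<Sum>i<n. v $ \<sigma> i) = S"
    unfolding S_def by (rule sum.reindex_bij_witness[of _ \<sigma> \<sigma>]) (auto simp: \<sigma>)
  moreover have "(\<Sum>i<n. d * v $ i + v $ \<sigma> i - S) = (\<Sum>i<n. x * v $ i)"
    by (rule sum.cong) (auto simp: row)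
  ultimately have "d * S + S - of_nat n * S = x * S"
    by (simp add: sum.distrib sum_subtractf sum_distrib_left[symmetric] S_def)
  \<comment> \<open>As d + 1 = n, the left side is zero, so x S = 0.\<close>
  then have "S = 0" using False by (simp add: d_def algebra_simps)
  define \<mu> where "\<mu> = x - d"
  have swap: "v $ \<sigma> i = \<mu> * v $ i" if "i < n" for i
    using row[OF that] \<open>S = 0\<close> by (simp add: \<mu>_def algebra_simps)
  obtain i where i: "i < n" "v $ i \<noteq> 0" using v(1,2) by (auto simp: vec_eq_iff)
  have "v $ i = \<mu> * (\<mu> * v $ i)"
    using swap[OF i(1)] swap[OF \<sigma>(1)[OF i(1)]] \<sigma>(2)[OF i(1)] by simp
  then have "\<mu>\<^sup>2 = 1" using i(2) by (simp add: power2_eq_square)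
  then have "\<mu> = 1 \<or> \<mu> = -1" by (simp add: power2_eq_1_iff)
  then show ?thesis by (auto simp: \<mu>_def d_def algebra_simps)
qed simp

text \<open>The three multiplicities solve a linear system: they add up to \<open>n\<close>, and the
  traces of \<open>A\<close> and of its square give two more equations. The assumption n > 2 keeps
  the values 0, n - 2 and n distinct.\<close>

lemma char_poly_roots_complement_matching:
  fixes A :: "complex mat" and n :: nat
  defines "d \<equiv> (of_nat n - 1 :: complex)"
  assumes n: "n > 2"
    and \<sigma>: "\<And>i. i < n \<Longrightarrow> \<sigma> i < n" "\<And>i. i < n \<Longrightarrow> \<sigma> (\<sigma> i) = i"
    and A: "A = mat n n (\<lambda>(i, j). (if i = j then d else 0) + (if j = \<sigma> i then 1 else 0) - 1)"
    and m: "card {i. i < n \<and> \<sigma> i \<noteq> i} = 2 * m"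
  shows "proots (char_poly A) =
    {#0#} + replicate_mset m (of_nat n - 2) + replicate_mset (n - 1 - m) (of_nat n)"
proof -
  have Ac: "A \<in> carrier_mat n n" by (simp add: A)
  obtain es where es: "char_poly A = (\<Prod>e\<leftarrow>es. [:- e, 1:])" and len: "length es = n"
    using char_poly_factorized[OF Ac] by blast
  have "proots (char_poly A) = mset es"
    unfolding es by (rule proots_prod_linear_factors)
  have "e \<in> {0, of_nat n - 2, of_nat n}" if "e \<in> set es" for e
  proof -
    have "poly (char_poly A) e = 0" unfolding es using that by (rule linear_poly_root)
    then have "eigenvalue A e" using eigenvalue_root_char_poly[OF Ac] by simp
    from eigenvalues_complement_matching[OF \<sigma> A[unfolded d_def] this] show ?thesis by simp
  qed
  then have sub: "set es \<subseteq> {0, of_nat n - 2, of_nat n}" by blast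
  define a b c where "a = count (mset es) 0" and "b = count (mset es) (of_nat n - 2)"
    and "c = count (mset es) (of_nat n)"
  have n': "(of_nat n :: complex) \<noteq> 0" "(of_nat n :: complex) - 2 \<noteq> 0"
    using n of_nat_eq_iff[of n 2, where ?'a = complex] by auto
  have mset: "mset es = replicate_mset a 0 + replicate_mset b (of_nat n - 2)
      + replicate_mset c (of_nat n)"
  proof (rule multiset_eqI)
    fix x show "count (mset es) x = count (replicate_mset a 0 + replicate_mset b (of_nat n - 2)
        + replicate_mset c (of_nat n)) x"
      using sub n' by (cases "x \<in> set es")
        (auto simp: a_def b_def c_def count_eq_zero_iff simp del: count_mset)
  qed
  have abc: "a + b + c = n" using arg_cong[OF mset, of size] len by simp
  have pow: "(\<Sum>e\<leftarrow>es. e ^ k) = of_nat a * 0 ^ k + of_nat b * (of_nat n - 2) ^ k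
      + of_nat c * of_nat n ^ k" for k
  proof -
    have "(\<Sum>e\<leftarrow>es. e ^ k) = (\<Sum>e\<in>#mset es. e ^ k)" by (simp flip: sum_mset_sum_list)
    also have "\<dots> = of_nat a * 0 ^ k + of_nat b * (of_nat n - 2) ^ k + of_nat c * of_nat n ^ k"
      unfolding mset by simp
    finally show ?thesis .
  qed
  \<comment> \<open>Indicator of the fixed points of \<sigma>: the diagonal entry of
    \<open>A\<close> at \<open>i\<close> is \<open>d - 1 + fx i\<close>.\<close>
  define fx where "fx i = (if \<sigma> i = i then 1 else 0 :: complex)" for i
  have fx: "(\<Sum>i<n. fx i) = of_nat n - 2 * of_nat m"
  proof -
    have "(\<Sum>i<n. fx i) = (\<Sum>i<n. 1 - (if \<sigma> i \<noteq> i then 1 else 0))"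
      by (rule sum.cong) (auto simp: fx_def)
    also have "\<dots> = of_nat n - of_nat (card {i. i < n \<and> \<sigma> i \<noteq> i})"
      by (simp add: sum_subtractf sum.If_cases Int_def)
    finally show ?thesis by (simp add: m)
  qed
  have "of_nat b * (of_nat n - 2) + of_nat c * of_nat n = (\<Sum>e\<leftarrow>es. e ^ 1)"
    by (subst pow) simp
  also have "\<dots> = trace_mat (A ^\<^sub>m 1)" using trace_mat_pow_eq_sum_eigenvalues[OF Ac es] ..
  also have "\<dots> = (\<Sum>i<n. d - 1 + fx i)"
    unfolding trace_mat_def by (rule sum.cong) (auto simp: A fx_def)
  also have "\<dots> = of_nat n * (d - 1) + of_nat n - 2 * of_nat m"
    by (simp add: sum.distrib fx)
  finally have tr1: "of_nat b * (of_nat n - 2) + of_nat c * of_nat n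
      = of_nat n * (d - 1) + of_nat n - 2 * of_nat m" .
  have "of_nat b * (of_nat n - 2)\<^sup>2 + of_nat c * (of_nat n)\<^sup>2 = (\<Sum>e\<leftarrow>es. e ^ 2)"
    by (subst pow) simp
  also have "\<dots> = trace_mat (A ^\<^sub>m 2)" using trace_mat_pow_eq_sum_eigenvalues[OF Ac es] ..
  also have "\<dots> = (\<Sum>i<n. \<Sum>j<n. A $$ (i, j) * A $$ (j, i))"
    using Ac by (simp add: trace_mat_def numeral_2_eq_2 scalar_prod_def atLeast0LessThan)
  also have "\<dots> = (\<Sum>i<n. d\<^sup>2 - d + 2 * d * fx i)"
  proof (rule sum.cong[OF refl])
    fix i assume "i \<in> {..<n}"
    then have i: "i < n" by simp
    \<comment> \<open>A generic off-diagonal entry is -1 and contributes 1. The other two summands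
      correct this at the position \<open>\<sigma> i\<close>, where an off-diagonal entry is 0, and
      on the diagonal, whose square is (d - 1)^2 or, at a fixed point, d^2.\<close>
    have "(\<Sum>j<n. A $$ (i, j) * A $$ (j, i)) =
        (\<Sum>j<n. (if j = i then d\<^sup>2 - 2 * d + 2 * d * fx i else 0) + (if j = \<sigma> i then -1 else 0) + 1)"
    proof (rule sum.cong[OF refl])
      fix j assume "j \<in> {..<n}"
      then have j: "j < n" by simp
      \<comment> \<open>An involution has a symmetric permutation matrix, so \<open>A\<close> is
        symmetric.\<close>
      have "i = \<sigma> j \<longleftrightarrow> j = \<sigma> i" using i j \<sigma> by metis
      then show "A $$ (i, j) * A $$ (j, i) =
          (if j = i then d\<^sup>2 - 2 * d + 2 * d * fx i else 0) + (if j = \<sigma> i then -1 else 0) + 1"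
        using i j by (auto simp: A fx_def power2_eq_square algebra_simps)
    qed
    also have "\<dots> = d\<^sup>2 - 2 * d + 2 * d * fx i - 1 + of_nat n"
      using i \<sigma>(1)[OF i] by (simp add: sum.distrib)
    finally show "(\<Sum>j<n. A $$ (i, j) * A $$ (j, i)) = d\<^sup>2 - d + 2 * d * fx i"
      by (simp add: d_def)
  qed
  also have "\<dots> = of_nat n * (d\<^sup>2 - d) + 2 * d * (of_nat n - 2 * of_nat m)"
    by (simp add: sum.distrib sum_distrib_left[symmetric] fx)
  finally have tr2: "of_nat b * (of_nat n - 2)\<^sup>2 + of_nat c * (of_nat n)\<^sup>2
      = of_nat n * (d\<^sup>2 - d) + 2 * d * (of_nat n - 2 * of_nat m)" .
  \<comment> \<open>Subtracting the second trace equation from \<open>n\<close> times the first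
    eliminates \<open>c\<close>.\<close>
  have "2 * (of_nat n - 2) * (of_nat b :: complex) =
      of_nat n * (of_nat b * (of_nat n - 2) + of_nat c * of_nat n)
      - (of_nat b * (of_nat n - 2)\<^sup>2 + of_nat c * (of_nat n)\<^sup>2)"
    by (simp add: power2_eq_square algebra_simps)
  also have "\<dots> = 2 * (of_nat n - 2) * (of_nat m :: complex)"
    unfolding tr1 tr2 by (simp add: d_def power2_eq_square algebra_simps)
  finally have b: "b = m" using n' by simp
  have "of_nat n * (of_nat c + of_nat m + 1) = of_nat n * (of_nat n :: complex)"
    using tr1 unfolding d_def b by (simp add: algebra_simps)
  then have "of_nat (c + m + 1) = (of_nat n :: complex)" using n' by (simp add: add_ac)
  then have "c + m + 1 = n" by (simp only: of_nat_eq_iff)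
  then have "c = n - 1 - m" "a = 1" using abc b by auto
  then show ?thesis using \<open>proots (char_poly A) = mset es\<close> mset b by simp
qed

section \<open>From the matrix to the Laplacian of a graph\<close>

text \<open>The missing edges are the pairs \<open>{v, \<tau> v}\<close> with
  \<open>\<tau> v \<noteq> v\<close>, so there are \<open>m\<close> of them. A vertex has degree n -
  2, or n - 1 if \<tau> fixes it. Moved to positions in the sorted vertex list, \<tau> becomes an
  involution \<sigma> of the indices, and the Laplacian takes the form (n-1) I + P - J.\<close>

lemma laplacian_spectrum_complement_matching:
  fixes \<Gamma> :: "'a::linorder pair_pre_digraph"
  assumes n: "card (pverts \<Gamma>) = n" "n > 2"
    and \<tau>: "\<And>v. v \<in> pverts \<Gamma> \<Longrightarrow> \<tau> v \<in> pverts \<Gamma>" "\<And>v. v \<in> pverts \<Gamma> \<Longrightarrow> \<tau> (\<tau> v) = v"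
    and arcs: "parcs \<Gamma> = {(u, v). u \<in> pverts \<Gamma> \<and> v \<in> pverts \<Gamma> \<and> u \<noteq> v \<and> v \<noteq> \<tau> u}"
    and m: "card {v \<in> pverts \<Gamma>. \<tau> v \<noteq> v} = 2 * m"
  shows "laplacian_spectrum \<Gamma> =
    {#0#} + replicate_mset m (of_nat n - 2) + replicate_mset (n - 1 - m) (of_nat n)"
proof -
  \<comment> \<open>An infinite set has \<open>card\<close> 0, so the positive cardinality yields
    finiteness.\<close>
  have fin: "finite (pverts \<Gamma>)" using n by (auto intro: card_ge_0_finite)
  define vs where "vs = vertex_list \<Gamma>"
  have vs: "set vs = pverts \<Gamma>" "distinct vs" "length vs = n"
    using fin n by (auto simp: vs_def vertex_list_def)
  then have bij: "bij_betw ((!) vs) {..<n} (pverts \<Gamma>)"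
    by (auto intro: bij_betw_nth)
  note inj = bij_betw_imp_inj_on[OF bij] and img = bij_betw_imp_surj_on[OF bij]
  define ix where "ix = the_inv_into {..<n} ((!) vs)"
  have ix: "ix v < n" "vs ! ix v = v" if "v \<in> pverts \<Gamma>" for v
    using the_inv_into_into[OF inj _ subset_refl] f_the_inv_into_f[OF inj] that
    unfolding ix_def img by blast+
  have ix_nth: "ix (vs ! i) = i" if "i < n" for i
    using that by (simp add: ix_def the_inv_into_f_f[OF inj])
  have nth: "vs ! i \<in> pverts \<Gamma>" if "i < n" for i
    using nth_mem[of i vs] that by (simp add: vs(1,3))
  define \<sigma> where "\<sigma> i = ix (\<tau> (vs ! i))" for i
  have \<sigma>: "\<sigma> i < n" "vs ! \<sigma> i = \<tau> (vs ! i)" if "i < n" for i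
    using ix[OF \<tau>(1)[OF nth[OF that]]] by (simp_all add: \<sigma>_def)
  have \<sigma>\<sigma>: "\<sigma> (\<sigma> i) = i" if "i < n" for i
    using \<sigma>[OF that] \<tau>(2)[OF nth[OF that]] ix_nth[OF that] by (simp add: \<sigma>_def)
  have \<sigma>_eq: "j = \<sigma> i \<longleftrightarrow> vs ! j = \<tau> (vs ! i)" if "i < n" "j < n" for i j
    using \<sigma>[OF that(1)] that vs by (metis nth_eq_iff_index_eq)
  have nth_eq: "vs ! i = vs ! j \<longleftrightarrow> i = j" if "i < n" "j < n" for i j
    using that vs by (metis nth_eq_iff_index_eq)
  have deg: "of_nat (out_degree (with_proj \<Gamma>) v) =
      (of_nat n - 2 + (if \<tau> v = v then 1 else 0) :: complex)" if v: "v \<in> pverts \<Gamma>" for v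
  proof -
    \<comment> \<open>The set \<open>{v, \<tau> v}\<close> has one element at a fixed point and two
      otherwise, which accounts for both possible degrees.\<close>
    have "out_arcs (with_proj \<Gamma>) v = Pair v ` (pverts \<Gamma> - {v, \<tau> v})"
      using v by (auto simp: out_arcs_def arcs)
    then have "out_degree (with_proj \<Gamma>) v = card (pverts \<Gamma> - {v, \<tau> v})"
      by (simp add: out_degree_def card_image inj_on_def)
    also have "\<dots> = n - card {v, \<tau> v}"
      using v \<tau>(1)[OF v] n(1) by (subst card_Diff_subset) auto
    finally show ?thesis using n(2) by (auto simp: of_nat_diff)
  qed
  have L: "laplacian_mat \<Gamma> = mat n n (\<lambda>(i, j).
      (if i = j then of_nat n - 1 else 0) + (if j = \<sigma> i then 1 else 0) - 1)"
    (is "_ = mat n n ?L")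
  proof (rule eq_matI)
    fix i j assume "i < dim_row (mat n n ?L)" "j < dim_col (mat n n ?L)"
    then have ij: "i < n" "j < n" by auto
    have "laplacian_mat \<Gamma> $$ (i, j) =
        (if i = j then of_nat (out_degree (with_proj \<Gamma>) (vs ! i)) else 0)
        - (if (vs ! i, vs ! j) \<in> parcs \<Gamma> then 1 else 0)"
      using ij by (simp add: laplacian_mat_def degree_mat_def adjacency_mat_def Let_def
          vs_def[symmetric] vs(3))
    also have "\<dots> = ?L (i, j)"
    proof -
      have arc: "(vs ! i, vs ! j) \<in> parcs \<Gamma> \<longleftrightarrow> i \<noteq> j \<and> \<sigma> i \<noteq> j"
        unfolding arcs using nth[OF ij(1)] nth[OF ij(2)] nth_eq[OF ij] \<sigma>_eq[OF ij]
        by (simp, metis)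
      have fixed: "\<tau> (vs ! i) = vs ! i \<longleftrightarrow> \<sigma> i = i"
        using \<sigma>_eq[OF ij(1) ij(1)] by metis
      show ?thesis
        unfolding deg[OF nth[OF ij(1)]] arc fixed by (cases "i = j"; cases "\<sigma> i = j") simp_all
    qed
    finally show "laplacian_mat \<Gamma> $$ (i, j) = mat n n ?L $$ (i, j)" using ij by simp
  qed (simp_all add: laplacian_mat_def degree_mat_def adjacency_mat_def Let_def
      vs_def[symmetric] vs(3))
  have moved_points: "card {i. i < n \<and> \<sigma> i \<noteq> i} = 2 * m"
  proof -
    have "(!) vs ` {i. i < n \<and> \<sigma> i \<noteq> i} = {v \<in> pverts \<Gamma>. \<tau> v \<noteq> v}"
    proof (intro equalityI subsetI)
      fix v assume v: "v \<in> {v \<in> pverts \<Gamma>. \<tau> v \<noteq> v}"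
      then have "\<sigma> (ix v) \<noteq> ix v" using ix[of v] \<sigma>_eq[of "ix v" "ix v"] by auto
      then show "v \<in> (!) vs ` {i. i < n \<and> \<sigma> i \<noteq> i}"
        using ix[of v] v by (intro image_eqI[of _ _ "ix v"]) auto
    next
      fix v assume "v \<in> (!) vs ` {i. i < n \<and> \<sigma> i \<noteq> i}"
      then obtain i where "i < n" "\<sigma> i \<noteq> i" "v = vs ! i" by blast
      then show "v \<in> {v \<in> pverts \<Gamma>. \<tau> v \<noteq> v}"
        using nth[of i] \<sigma>_eq[of i i] by auto
    qed
    moreover have "inj_on ((!) vs) {i. i < n \<and> \<sigma> i \<noteq> i}"
      using nth_eq by (auto simp: inj_on_def)
    ultimately show ?thesis using m card_image[of "(!) vs" "{i. i < n \<and> \<sigma> i \<noteq> i}"] by simp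
  qed
  show ?thesis
    unfolding laplacian_spectrum_def
    by (rule char_poly_roots_complement_matching[OF n(2) _ _ L moved_points])
      (simp_all add: \<sigma>(1) \<sigma>\<sigma>)
qed

section \<open>Isomorphisms and supergraphs of (n-2)-regular graphs\<close>

text \<open>A \<open>digraph_iso\<close> carries independent maps for vertices, arcs, tails and
  heads. Between pair digraphs the new tail and head must be \<open>fst\<close> and
  \<open>snd\<close>, so the arc map is induced by the vertex map.\<close>

lemma digraph_iso_with_projE:
  assumes "digraph_iso (with_proj \<Gamma>) (with_proj \<Gamma>')"
  obtains f where "inj_on f (pverts \<Gamma>)" "pverts \<Gamma>' = f ` pverts \<Gamma>"
    "parcs \<Gamma>' = map_prod f f ` parcs \<Gamma>"
proof -
  obtain h where h: "pre_digraph.digraph_isomorphism (with_proj \<Gamma>) h"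
    and \<Gamma>': "with_proj \<Gamma>' = app_iso h (with_proj \<Gamma>)"
    using assms by (auto simp: digraph_iso_def)
  have tail: "iso_tail h = fst" and head: "iso_head h = snd"
    using arg_cong[OF \<Gamma>', of tail] arg_cong[OF \<Gamma>', of head] by auto
  have "iso_arcs h a = map_prod (iso_verts h) (iso_verts h) a" if "a \<in> parcs \<Gamma>" for a
    using h that unfolding pre_digraph.digraph_isomorphism_def
    by (auto simp: tail head prod_eq_iff)
  then have "parcs \<Gamma>' = map_prod (iso_verts h) (iso_verts h) ` parcs \<Gamma>"
    using arg_cong[OF \<Gamma>', of arcs] by (auto simp: image_iff)
  moreover have "inj_on (iso_verts h) (pverts \<Gamma>)"
    using h by (simp add: pre_digraph.digraph_isomorphism_def)
  moreover have "pverts \<Gamma>' = iso_verts h ` pverts \<Gamma>"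
    using arg_cong[OF \<Gamma>', of verts] by simp
  ultimately show ?thesis using that by blast
qed

text \<open>By regularity each vertex misses exactly one other vertex, so the non-edges of
  \<open>D\<close> form a perfect matching with partner map \<open>p\<close>. Adding edges deletes
  pairs from this matching: \<tau> is the identity on the endpoints of new edges and
  \<open>p\<close> elsewhere.\<close>

lemma adds_edges_complement_matching:
  fixes D H :: "'a pair_pre_digraph"
  assumes D: "pair_bidirected_digraph D" and fin: "finite (pverts D)"
    and n: "card (pverts D) \<ge> 2" and reg: "regular_graph (card (pverts D) - 2) D"
    and H: "adds_edges k D H"
  obtains \<tau> where "\<And>v. v \<in> pverts H \<Longrightarrow> \<tau> v \<in> pverts H" "\<And>v. v \<in> pverts H \<Longrightarrow> \<tau> (\<tau> v) = v"
    "parcs H = {(u, v). u \<in> pverts H \<and> v \<in> pverts H \<and> u \<noteq> v \<and> v \<noteq> \<tau> u}"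
    "card {v \<in> pverts H. \<tau> v \<noteq> v} = card (pverts H) - 2 * k"
proof -
  interpret pair_bidirected_digraph D by (rule D)
  define V where "V = pverts D"
  have irr: "(v, v) \<notin> parcs D" for v using no_loops[of "(v, v)"] by auto
  have sym: "(u, v) \<in> parcs D \<longleftrightarrow> (v, u) \<in> parcs D" for u v
    using arcs_symmetric by blast
  have inV: "u \<in> V" "v \<in> V" if "(u, v) \<in> parcs D" for u v
    using that in_arcsD1 in_arcsD2 by (auto simp: V_def)
  have "\<exists>w. {w \<in> V. w \<noteq> v \<and> (v, w) \<notin> parcs D} = {w}" if v: "v \<in> V" for v
  proof -
    \<comment> \<open>The neighbourhood of \<open>v\<close>: removing it and \<open>v\<close> itself
      from \<open>V\<close> leaves (n - 1) - (n - 2) = 1 vertex, with n the number of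
      vertices.\<close>
    define W where "W = {w. (v, w) \<in> parcs D}"
    have "out_arcs (with_proj D) v = Pair v ` W"
      by (auto simp: out_arcs_def W_def)
    then have "out_degree (with_proj D) v = card W"
      by (simp add: out_degree_def card_image inj_on_def)
    then have "card W = card V - 2"
      using reg v by (simp add: regular_graph_def V_def)
    moreover have "W \<subseteq> V - {v}" using inV irr by (auto simp: W_def)
    moreover have "finite V" using fin by (simp add: V_def)
    ultimately have "card (V - {v} - W) = 1"
      using n v by (subst card_Diff_subset) (auto simp: V_def intro: finite_subset)
    moreover have "V - {v} - W = {w \<in> V. w \<noteq> v \<and> (v, w) \<notin> parcs D}"
      by (auto simp: W_def)
    ultimately show ?thesis by (metis card_1_singletonE)
  qed
  then obtain p where p: "\<And>v. v \<in> V \<Longrightarrow> {w \<in> V. w \<noteq> v \<and> (v, w) \<notin> parcs D} = {p v}"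
    by metis
  have p_iff: "w \<in> V \<and> w \<noteq> v \<and> (v, w) \<notin> parcs D \<longleftrightarrow> w = p v" if "v \<in> V" for v w
    using p[OF that] by blast
  have pV: "p v \<in> V" "p v \<noteq> v" if "v \<in> V" for v using p_iff[OF that, of "p v"] by auto
  \<comment> \<open>Non-adjacency is symmetric, so \<open>v\<close> is in turn the only vertex
    missed by \<open>p v\<close>.\<close>
  have pp: "p (p v) = v" if "v \<in> V" for v
    using p_iff[OF that, of "p v"] p_iff[OF pV(1)[OF that], of v] that sym by auto
  have non: "nonedges D = (\<lambda>v. {v, p v}) ` V"
  proof (intro equalityI subsetI)
    fix e assume "e \<in> nonedges D"
    then obtain u v where "e = {u, v}" "u \<in> V" "v \<in> V" "u \<noteq> v" "(u, v) \<notin> parcs D"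
      unfolding nonedges_def V_def by blast
    then have "v = p u" using p_iff[of u v] by blast
    with \<open>u \<in> V\<close> \<open>e = {u, v}\<close> show "e \<in> (\<lambda>v. {v, p v}) ` V" by blast
  next
    fix e assume "e \<in> (\<lambda>v. {v, p v}) ` V"
    then obtain v where "v \<in> V" "e = {v, p v}" by auto
    moreover have "(v, p v) \<notin> parcs D" using p_iff[OF \<open>v \<in> V\<close>, of "p v"] by simp
    ultimately show "e \<in> nonedges D"
      using pV[of v] unfolding nonedges_def V_def[symmetric] mem_Collect_eq
      by (intro exI[of _ v] exI[of _ "p v"]) simp
  qed
  obtain N where N: "N \<subseteq> nonedges D" "card N = k" and HV: "pverts H = V"
    and HA: "parcs H = parcs D \<union> {(u, v). {u, v} \<in> N}"
    using H by (auto simp: adds_edges_def V_def)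
  \<comment> \<open>Either endpoint determines the edge, hence distinct members of \<open>N\<close>
    are disjoint.\<close>
  have edge_eq: "e = {v, p v}" if e: "e \<in> N" "v \<in> e" for e v
  proof -
    obtain w where "w \<in> V" "e = {w, p w}" using e(1) N(1) unfolding non by blast
    then show ?thesis using e(2) pp[of w] by auto
  qed
  define \<tau> where "\<tau> v = (if {v, p v} \<in> N then v else p v)" for v
  show thesis
  proof (rule that[of \<tau>])
    show "\<tau> v \<in> pverts H" if "v \<in> pverts H" for v
      using that pV by (auto simp: HV \<tau>_def)
    show "\<tau> (\<tau> v) = v" if "v \<in> pverts H" for v
      using that pp by (auto simp: HV \<tau>_def insert_commute)
    have "(u, v) \<in> parcs H \<longleftrightarrow> u \<in> V \<and> v \<in> V \<and> u \<noteq> v \<and> v \<noteq> \<tau> u" for u v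
    proof (cases "{u, v} \<in> N")
      case True
      then obtain w where w: "w \<in> V" "{u, v} = {w, p w}"
        using N(1) unfolding non by blast
      then have uv: "u \<in> V" "v \<in> V" "v = p u"
        using pV[of w] pp[of w] by (auto simp: doubleton_eq_iff)
      with True show ?thesis using pV[of u] by (simp add: HA \<tau>_def)
    next
      case False
      then have "(u, v) \<in> parcs H \<longleftrightarrow> (u, v) \<in> parcs D" by (simp add: HA)
      moreover have "v \<noteq> u \<Longrightarrow> v = \<tau> u \<longleftrightarrow> v = p u" using False by (auto simp: \<tau>_def)
      ultimately show ?thesis using p_iff[of u v] inV[of u v] irr[of u] by metis
    qed
    then show "parcs H = {(u, v). u \<in> pverts H \<and> v \<in> pverts H \<and> u \<noteq> v \<and> v \<noteq> \<tau> u}"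
      by (auto simp: HV)
    \<comment> \<open>The new edges cover exactly the fixed points of \<tau>; being disjoint pairs,
      they cover 2k vertices.\<close>
    have "card (\<Union>N) = (\<Sum>e\<in>N. card e)"
    proof (rule card_Union_disjoint)
      show "pairwise disjnt N" using edge_eq by (auto simp: pairwise_def disjnt_iff)
      show "finite e" if "e \<in> N" for e using that N(1) by (auto simp: non)
    qed
    also have "\<dots> = (\<Sum>e\<in>N. 2)"
    proof (rule sum.cong[OF refl])
      fix e assume "e \<in> N"
      then obtain v where "v \<in> V" "e = {v, p v}" using N(1) unfolding non by blast
      then show "card e = 2" using pV(2)[of v] by simp
    qed
    finally have "card (\<Union>N) = 2 * k" using N(2) by simp
    moreover have "\<Union>N \<subseteq> V" using N(1) pV(1) unfolding non by blast
    moreover have "{v \<in> pverts H. \<tau> v \<noteq> v} = V - \<Union>N"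
    proof -
      have "v \<in> \<Union>N \<longleftrightarrow> {v, p v} \<in> N" for v using edge_eq by blast
      then show ?thesis using pV(2) by (auto simp: HV \<tau>_def)
    qed
    moreover have "finite (\<Union>N)" using \<open>\<Union>N \<subseteq> V\<close> fin finite_subset by (auto simp: V_def)
    ultimately show "card {v \<in> pverts H. \<tau> v \<noteq> v} = card (pverts H) - 2 * k"
      by (simp add: card_Diff_subset HV)
  qed
qed

text \<open>Since graphs are taken up to isomorphism, the supergraph \<open>H\<close> lives on the
  primes of \<open>G\<close>, and the degree graph of \<open>G1\<close> is only isomorphic to it.
  The matching is found in \<open>H\<close> and then transported.\<close>

theorem corollary3p8:
  fixes G :: "('a, 'c) monoid_scheme" and G1 :: "('b, 'd) monoid_scheme"
    and n n1 :: nat and H :: "nat pair_pre_digraph"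
  assumes "n \<ge> 4" and "even n"
    and "group G" and "finite (carrier G)" and "solvable G"
    and "card (pverts (degree_graph G)) = n"
    and "regular_graph (n - 2) (degree_graph G)"
    and "1 \<le> n1" and "n1 \<le> n div 2"
    and "group G1" and "finite (carrier G1)" and "solvable G1"
    and "adds_edges n1 (degree_graph G) H"
    and "digraph_iso (with_proj H) (with_proj (degree_graph G1))"
  shows "laplacian_spectrum (degree_graph G1) =
    replicate_mset 1 0 +
    replicate_mset (n div 2 - n1) (of_nat (n - 2)) +
    replicate_mset (n div 2 + n1 - 1) (of_nat n)"
proof -
  have fin: "finite (pverts (degree_graph G))"
    using assms(1,6) by (auto intro: card_ge_0_finite)
  have cardH: "card (pverts H) = n"
    using assms(6,13) by (auto simp: adds_edges_def)
  obtain \<tau> where \<tau>: "\<And>v. v \<in> pverts H \<Longrightarrow> \<tau> v \<in> pverts H"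
      "\<And>v. v \<in> pverts H \<Longrightarrow> \<tau> (\<tau> v) = v"
    and arcs: "parcs H = {(u, v). u \<in> pverts H \<and> v \<in> pverts H \<and> u \<noteq> v \<and> v \<noteq> \<tau> u}"
    and card: "card {v \<in> pverts H. \<tau> v \<noteq> v} = card (pverts H) - 2 * n1"
    using adds_edges_complement_matching[OF degree_graph_bidirected fin _ _ assms(13)] assms(1,6,7)
    by force
  obtain f where inj: "inj_on f (pverts H)" and verts1: "pverts (degree_graph G1) = f ` pverts H"
    and arcs1: "parcs (degree_graph G1) = map_prod f f ` parcs H"
    using assms(14) by (rule digraph_iso_with_projE)
  define g where "g = the_inv_into (pverts H) f"
  have g: "g (f v) = v" if "v \<in> pverts H" for v
    using inj that by (simp add: g_def the_inv_into_f_f)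
  have f_eq: "f u = f v \<longleftrightarrow> u = v" if "u \<in> pverts H" "v \<in> pverts H" for u v
    using inj that by (auto simp: inj_on_def)
  define m where "m = n div 2 - n1"
  have "laplacian_spectrum (degree_graph G1) =
    {#0#} + replicate_mset m (of_nat n - 2) + replicate_mset (n - 1 - m) (of_nat n)"
  \<comment> \<open>The involution of \<open>H\<close> conjugated by the isomorphism
    \<open>f\<close>, with \<open>g\<close> its inverse on the image.\<close>
  proof (rule laplacian_spectrum_complement_matching[where \<tau> = "\<lambda>w. f (\<tau> (g w))"])
    show "card (pverts (degree_graph G1)) = n"
      using cardH inj by (simp add: verts1 card_image)
    show "n > 2" using assms(1) by simp
    show "f (\<tau> (g w)) \<in> pverts (degree_graph G1)" if "w \<in> pverts (degree_graph G1)" for w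
      using that \<tau> g by (auto simp: verts1)
    show "f (\<tau> (g (f (\<tau> (g w))))) = w" if "w \<in> pverts (degree_graph G1)" for w
      using that \<tau> g by (auto simp: verts1)
    show "parcs (degree_graph G1) = {(u, v). u \<in> pverts (degree_graph G1) \<and>
        v \<in> pverts (degree_graph G1) \<and> u \<noteq> v \<and> v \<noteq> f (\<tau> (g u))}"
      unfolding arcs1 verts1 arcs by (force simp: g f_eq \<tau>)
    have "{w \<in> pverts (degree_graph G1). f (\<tau> (g w)) \<noteq> w} = f ` {v \<in> pverts H. \<tau> v \<noteq> v}"
      by (auto simp: verts1 g f_eq \<tau>)
    moreover have "inj_on f {v \<in> pverts H. \<tau> v \<noteq> v}" by (rule inj_on_subset[OF inj]) auto
    ultimately have "card {w \<in> pverts (degree_graph G1). f (\<tau> (g w)) \<noteq> w} = n - 2 * n1"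
      using card cardH by (simp add: card_image)
    \<comment> \<open>Evenness of \<open>n\<close> makes \<open>n div 2\<close> exact, so the
      unmatched count leaves n/2 - n1 missing edges.\<close>
    also have "\<dots> = 2 * m" using assms(2) by (auto simp: m_def)
    finally show "card {w \<in> pverts (degree_graph G1). f (\<tau> (g w)) \<noteq> w} = 2 * m" .
  qed
  \<comment> \<open>The bound n1 \<le> n/2 keeps the truncated subtraction in \<open>m\<close>
    exact.\<close>
  moreover have "n - 1 - m = n div 2 + n1 - 1"
    using assms(2,8,9) by (auto simp: m_def elim!: evenE)
  moreover have "of_nat (n - 2) = (of_nat n - 2 :: complex)"
    using assms(1) by (simp add: of_nat_diff)
  ultimately show ?thesis by (simp add: m_def)
qed

end
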